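(* For every integer $n\ge 0$, \[ \sum_{j=-n-1}^n q^{2j^2+j}{2n+1 \brack n-j}_{q^2}^2 = (1+q^{2n+1}){4n+1 \brack 2n}_q. \]
   Context: $(a;q)_n=\prod_{k=0}^{n-1}(1-aq^k)$. The Gaussian polynomial is ${m\brack k}_q=\frac{(q;q)_m}{(q;q)_k(q;q)_{m-k}}$ for $0\le k\le m$ and $0$ otherwise; ${m\brack k}_{q^2}$ is the same with $q$ replaced by $q^2$. *)

theory Defs
  imports "HOL-Computational_Algebra.Computational_Algebra"
begin

definition qpoch :: "'a::field \<Rightarrow> 'a \<Rightarrow> nat \<Rightarrow> 'a" where
  "qpoch a q n = (\<Prod>k<n. 1 - a * q ^ k)"

definition gauss_binomial :: "'a::field \<Rightarrow> nat \<Rightarrow> int \<Rightarrow> 'a" where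
  "gauss_binomial q m k =
     (if 0 \<le> k \<and> k \<le> int m
      then qpoch q q m / (qpoch q q (nat k) * qpoch q q (m - nat k))
      else 0)"

text \<open>The indeterminate \<open>q\<close>, as an element of the fraction field of the polynomial ring
  over the integers. Neither \<open>q\<close> nor \<open>q\<^sup>2\<close> is a root of unity there, so the denominators of the
  Gaussian polynomials in \<open>q\<close> and \<open>q\<^sup>2\<close> do not vanish (proved below).\<close>

definition qvar :: "int poly fract" where
  "qvar = Fract [:0, 1:] 1"

lemma qvar_power: "qvar ^ k = Fract (monom 1 k) 1"
proof (induction k)
  case 0
  show ?case by (simp add: One_fract_def)
next
  case (Suc k)
  then show ?case by (simp add: qvar_def monom_Suc)
qed

lemma qvar_power_neq_1:
  assumes "k > 0"
  shows "qvar ^ k \<noteq> 1"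
proof
  assume "qvar ^ k = 1"
  then have "monom (1::int) k = 1"
    by (simp add: qvar_power One_fract_def eq_fract)
  then have "degree (monom (1::int) k) = 0" by simp
  then show False using assms by (simp add: degree_monom_eq)
qed

lemma qpoch_qvar_power_neq_0:
  assumes "r > 0"
  shows "qpoch (qvar ^ r) (qvar ^ r) n \<noteq> 0"
proof -
  have "1 - qvar ^ r * (qvar ^ r) ^ k \<noteq> 0" for k
    using qvar_power_neq_1[of "r + r * k"] assms
    by (simp add: power_add power_mult)
  then show ?thesis by (simp add: qpoch_def)
qed

end

theory Submission
  imports Defs
begin

text \<open>
  Write \<open>[m, k]\<close> for the Gaussian polynomial. By the \<open>q\<close>-binomial theorem, the coefficient
  of \<open>x^k\<close> in \<open>\<Prod>i<m. 1 + c q^i x\<close> is \<open>c^k q^(k choose 2) [m, k]\<close>. With \<open>N = 2n + 1\<close>, split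
  \<open>\<Prod>i<2N. 1 + q^i x\<close> into its factors with odd and even \<open>i\<close>, which are products of the same
  kind in base \<open>q\<^sup>2\<close>, and compare the coefficients of \<open>x^N\<close>. With \<open>k = n - j\<close>, the left-hand side
  of the theorem turns out to be \<open>[2N, N]\<close>.
\<close>

lemma qpoch_0 [simp]: "qpoch a q 0 = 1"
  by (simp add: qpoch_def)

lemma qpoch_Suc: "qpoch a q (Suc n) = qpoch a q n * (1 - a * q ^ n)"
  by (simp add: qpoch_def)

lemma gauss_binomial_of_nat:
  "gauss_binomial q m (int k) =
     (if k \<le> m then qpoch q q m / (qpoch q q k * qpoch q q (m - k)) else 0)"
  by (simp add: gauss_binomial_def)

lemma gauss_binomial_0:
  assumes "qpoch q q m \<noteq> 0"
  shows "gauss_binomial q m 0 = 1"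
  using assms by (simp add: gauss_binomial_def)

lemma gauss_binomial_symmetric:
  assumes "k \<le> m"
  shows "gauss_binomial q m (int (m - k)) = gauss_binomial q m (int k)"
  using assms unfolding gauss_binomial_of_nat by (simp add: mult.commute)

text \<open>Of the two \<open>q\<close>-Pascal rules, this one fits the appending of a last factor
  \<open>1 + c q^m x\<close> to the product in the \<open>q\<close>-binomial theorem.\<close>

lemma gauss_binomial_Suc_Suc:
  fixes q :: "'a::field"
  assumes nz: "\<And>m. qpoch q q m \<noteq> 0" and "k \<le> m"
  shows "gauss_binomial q (Suc m) (int (Suc k)) =
           gauss_binomial q m (int (Suc k)) + q ^ (m - k) * gauss_binomial q m (int k)"
\<comment> \<open>For \<open>k = m\<close> the term \<open>[m, k + 1]\<close> is zero by convention
  and the quotient formula does not apply to it.\<close>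
proof (cases "k = m")
  case True
  then show ?thesis
    using nz by (simp add: gauss_binomial_of_nat del: of_nat_Suc)
next
  case False
  then obtain d where m: "m = k + Suc d"
    using \<open>k \<le> m\<close> by (metis add_Suc_right le_neq_implies_less less_imp_Suc_add)
  have nz_k: "1 - q * q ^ k \<noteq> 0" and nz_d: "1 - q * q ^ d \<noteq> 0"
    using nz[of "Suc k"] nz[of "Suc d"] by (auto simp: qpoch_Suc)
  define A B C where "A = qpoch q q k" and "B = qpoch q q d" and "C = qpoch q q m"
  have nz': "A \<noteq> 0" "B \<noteq> 0"
    using nz by (auto simp: A_def B_def)
  \<comment> \<open>With denominators cleared, this is
    \<open>1 - q^(m+1) = (1 - q^(d+1)) + q^(d+1) (1 - q^(k+1))\<close>, since
    \<open>m + 1 = (k + 1) + (d + 1)\<close>.\<close>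
  have "C * (1 - q * q ^ m) / (A * (1 - q * q ^ k) * (B * (1 - q * q ^ d))) =
      C / (A * (1 - q * q ^ k) * B) + q ^ Suc d * (C / (A * (B * (1 - q * q ^ d))))"
    using nz' nz_k nz_d unfolding m by (simp add: divide_simps power_add) (simp add: algebra_simps)
  then show ?thesis
    unfolding gauss_binomial_of_nat
    by (simp add: m A_def B_def C_def qpoch_Suc)
qed

text \<open>Absorption rule: the quotients differ only in their last factors. It later turns
  \<open>[2N, N]\<close> into a multiple of \<open>[4n + 1, 2n]\<close>.\<close>

lemma gauss_binomial_Suc_eq:
  fixes q :: "'a::field"
  assumes nz: "\<And>m. qpoch q q m \<noteq> 0" and "k \<le> m"
  shows "(1 - q ^ Suc k) * gauss_binomial q (Suc m) (int (Suc k)) =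
           (1 - q ^ Suc m) * gauss_binomial q m (int k)"
proof -
  have "1 - q * q ^ k \<noteq> 0"
    using nz[of "Suc k"] by (auto simp: qpoch_Suc)
  then show ?thesis
    using assms unfolding gauss_binomial_of_nat by (simp add: qpoch_Suc)
qed

text \<open>Induction on the number of factors. The parameter \<open>c\<close> is there for the
  factors with odd index, which have \<open>c = q\<close> in base \<open>q\<^sup>2\<close>.\<close>

theorem q_binomial_theorem:
  fixes q c :: "'a::field"
  assumes nz: "\<And>m. qpoch q q m \<noteq> 0"
  shows "coeff (\<Prod>i<m. [:1, c * q ^ i:]) k =
           c ^ k * q ^ (k choose 2) * gauss_binomial q m (int k)"
proof (induction m arbitrary: k)
  case 0
  show ?case
    by (cases k) (auto simp: gauss_binomial_def binomial_eq_0)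
next
  case (Suc m)
  have "(\<Prod>i<Suc m. [:1, c * q ^ i:]) =
      (\<Prod>i<m. [:1, c * q ^ i:]) + pCons 0 (smult (c * q ^ m) (\<Prod>i<m. [:1, c * q ^ i:]))"
    by (simp add: mult.commute)
  then have expand: "coeff (\<Prod>i<Suc m. [:1, c * q ^ i:]) k =
      coeff (\<Prod>i<m. [:1, c * q ^ i:]) k
      + (case k of 0 \<Rightarrow> 0 | Suc l \<Rightarrow> c * q ^ m * coeff (\<Prod>i<m. [:1, c * q ^ i:]) l)"
    by (simp add: coeff_pCons split: nat.split)
  show ?case
  proof (cases k)
    case 0
    then show ?thesis
      using expand nz by (simp add: Suc.IH gauss_binomial_0)
  next
    case (Suc l)
    show ?thesis
    proof (cases "l \<le> m")
      case True
      \<comment> \<open>The extra \<open>q^l\<close> from the binomial exponent and the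
        \<open>q^(m-l)\<close> from the Pascal rule make up the \<open>q^m\<close> of the new
        factor.\<close>
      have "Suc l choose 2 = l + (l choose 2)"
        by (simp add: numeral_2_eq_2)
      moreover have "q ^ m = q ^ l * q ^ (m - l)"
        using True by (simp flip: power_add)
      ultimately show ?thesis
        using Suc expand gauss_binomial_Suc_Suc[OF nz True]
        by (simp add: Suc.IH power_add algebra_simps del: of_nat_Suc)
    next
      case False
      then show ?thesis
        using Suc expand by (simp add: Suc.IH gauss_binomial_of_nat del: of_nat_Suc)
    qed
  qed
qed

lemma prod_lessThan_double:
  fixes f :: "nat \<Rightarrow> 'a::comm_monoid_mult"
  shows "(\<Prod>i<2 * m. f i) = (\<Prod>i<m. f (2 * i + 1)) * (\<Prod>i<m. f (2 * i))"
  by (induction m) (simp_all add: ac_simps)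

lemma sum_gauss_binomial_square:
  fixes q :: "'a::field"
  assumes nz: "\<And>m. qpoch q q m \<noteq> 0" and nz2: "\<And>m. qpoch (q\<^sup>2) (q\<^sup>2) m \<noteq> 0"
  shows "(\<Sum>k\<le>m. q ^ (k + 2 * (k choose 2) + 2 * ((m - k) choose 2)) *
             (gauss_binomial (q\<^sup>2) m (int k))\<^sup>2) =
         q ^ (m choose 2) * gauss_binomial q (2 * m) (int m)"
proof -
  \<comment> \<open>Odd exponents give \<open>q^(2i+1) = q (q\<^sup>2)^i\<close>. The factors
    \<open>1 *\<close> match the \<open>q\<close>-binomial theorem with
    \<open>c = 1\<close>.\<close>
  have "(\<Prod>i<2 * m. [:1, 1 * q ^ i:]) =
      (\<Prod>i<m. [:1, q * (q\<^sup>2) ^ i:]) * (\<Prod>i<m. [:1, 1 * (q\<^sup>2) ^ i:])"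
    by (simp add: prod_lessThan_double power_mult)
  then have "coeff (\<Prod>i<2 * m. [:1, 1 * q ^ i:]) m =
      (\<Sum>k\<le>m. coeff (\<Prod>i<m. [:1, q * (q\<^sup>2) ^ i:]) k *
               coeff (\<Prod>i<m. [:1, 1 * (q\<^sup>2) ^ i:]) (m - k))"
    by (simp only: coeff_mult)
  also have "\<dots> = (\<Sum>k\<le>m. q ^ (k + 2 * (k choose 2) + 2 * ((m - k) choose 2)) *
             (gauss_binomial (q\<^sup>2) m (int k))\<^sup>2)"
    \<comment> \<open>The symmetry \<open>[m, m - k] = [m, k]\<close> makes the product of the two
      coefficients a square.\<close>
    unfolding q_binomial_theorem[OF nz2]
    by (intro sum.cong refl)
      (simp add: gauss_binomial_symmetric power_add power_mult
        power2_eq_square[of "gauss_binomial _ _ _"] del: of_nat_diff)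
  finally show ?thesis
    unfolding q_binomial_theorem[OF nz] by simp
qed

lemma int_double_choose_2: "2 * int (k choose 2) = int k * (int k - 1)"
  by (induction k) (simp_all add: numeral_2_eq_2 algebra_simps)

theorem theorem8p1:
  fixes n :: nat
  shows "(\<Sum>j = - int n - 1..int n.
            qvar powi (2 * j\<^sup>2 + j) * (gauss_binomial (qvar\<^sup>2) (2 * n + 1) (int n - j))\<^sup>2)
         = (1 + qvar ^ (2 * n + 1)) * gauss_binomial qvar (4 * n + 1) (2 * int n)"
    (is "?lhs = ?rhs")
proof -
  define N where "N = 2 * n + 1"
  have nz: "qpoch qvar qvar m \<noteq> 0" and nz2: "qpoch (qvar\<^sup>2) (qvar\<^sup>2) m \<noteq> 0" for m
    using qpoch_qvar_power_neq_0[of 1] qpoch_qvar_power_neq_0[of 2] by simp_all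
  have q0: "qvar \<noteq> 0"
    by (simp add: qvar_def Zero_fract_def eq_fract)
  have exponent: "qvar ^ (N choose 2) * qvar powi (2 * (int n - int k)\<^sup>2 + (int n - int k)) =
      qvar ^ (k + 2 * (k choose 2) + 2 * ((N - k) choose 2))" if "k \<le> N" for k
  proof -
    \<comment> \<open>Doubling turns every binomial coefficient into a polynomial. With
      \<open>j = n - k\<close>, the identity is
      \<open>n(2n+1) + 2j^2 + j = (n-j)^2 + (n+j+1)(n+j)\<close>.\<close>
    have "2 * int (N choose 2) + 2 * (2 * (int n - int k)\<^sup>2 + (int n - int k)) =
        2 * (int k + 2 * int (k choose 2) + 2 * int ((N - k) choose 2))"
      using that unfolding distrib_left int_double_choose_2
      by (simp add: N_def of_nat_diff int_double_choose_2 power2_eq_square algebra_simps)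
    then have "int (N choose 2) + (2 * (int n - int k)\<^sup>2 + (int n - int k)) =
        int (k + 2 * (k choose 2) + 2 * ((N - k) choose 2))"
      by simp
    then show ?thesis
      using q0 by (metis power_int_add power_int_of_nat)
  qed
  have "?lhs = (\<Sum>k\<le>N. qvar powi (2 * (int n - int k)\<^sup>2 + (int n - int k)) *
      (gauss_binomial (qvar\<^sup>2) N (int k))\<^sup>2)"
    by (rule sum.reindex_bij_witness[where i = "\<lambda>k. int n - int k" and j = "\<lambda>j. nat (int n - j)"])
      (auto simp: N_def)
  then have "qvar ^ (N choose 2) * ?lhs =
      (\<Sum>k\<le>N. qvar ^ (k + 2 * (k choose 2) + 2 * ((N - k) choose 2)) *
             (gauss_binomial (qvar\<^sup>2) N (int k))\<^sup>2)"
    by (simp add: sum_distrib_left exponent flip: mult.assoc)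
  also have "\<dots> = qvar ^ (N choose 2) * gauss_binomial qvar (2 * N) (int N)"
    by (rule sum_gauss_binomial_square[OF nz nz2])
  finally have "?lhs = gauss_binomial qvar (2 * N) (int N)"
    using q0 by simp
  also have "\<dots> = ?rhs"
  proof -
    \<comment> \<open>Here \<open>2N = (4n + 1) + 1\<close> and \<open>N = 2n + 1\<close>, so one
      absorption step lowers both arguments; the quotient of the outer factors is
      \<open>1 + q^N\<close>.\<close>
    have "(1 - qvar ^ N) * gauss_binomial qvar (2 * N) (int N) =
        (1 - qvar ^ (2 * N)) * gauss_binomial qvar (4 * n + 1) (2 * int n)"
      using gauss_binomial_Suc_eq[OF nz, of "2 * n" "4 * n + 1"] by (simp add: N_def)
    also have "1 - qvar ^ (2 * N) = (1 - qvar ^ N) * (1 + qvar ^ N)"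
      by (simp add: mult_2 power_add ring_distribs)
    finally show ?thesis
      using qvar_power_neq_1[of N] by (simp add: N_def mult.assoc)
  qed
  finally show ?thesis .
qed

end
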